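(* Let $L\ge1$ be an integer, $\sigma^2>0$ and $m_I>0$. Let $g_d,g_1,\dots,g_L$ be mutually independent random variables such that $g_d$ is a unit-mean $\kappa$-$\mu$ power random variable with parameters $(\kappa,\mu)$ (positive reals) and $g_1,\dots,g_L$ are identically distributed unit-mean Nakagami power random variables with parameter $m_I$. Suppose $\mu>0.5$. Then the error vector magnitude in the presence of interference and noise, $\mathrm{EVM}=\mathbb{E}\left[\sqrt{\left(\sum_{l=1}^L g_l+\sigma^2\right)/g_d}\right]$, equals $$\left(\sigma^2\right)^{m_IL+0.5}\,U\!\left(m_IL,\ \tfrac32+m_IL,\ \sigma^2m_I\right)\sqrt{\mu(1+\kappa)}\;\frac{\Gamma(\mu-0.5)}{\Gamma(\mu)}\;{}_1F_1\!\left(\tfrac12;\,\mu;\,-\kappa\mu\right)m_I^{m_IL}.$$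
   Context: Unit-mean $\kappa$-$\mu$ power random variable with parameters $(\kappa,\mu)$, $\kappa,\mu>0$: a positive random variable with density $$f(x)=\frac{\mu(1+\kappa)^{\frac{\mu+1}{2}}}{\kappa^{\frac{\mu-1}{2}}e^{\mu\kappa}}\,x^{\frac{\mu-1}{2}}e^{-\mu(1+\kappa)x}\,I_{\mu-1}\!\left(2\mu\sqrt{\kappa(1+\kappa)x}\right),\quad x>0,$$ where $I_\nu$ is the modified Bessel function of the first kind. (This is the $m\to\infty$ limit of the unit-mean $\kappa$-$\mu$ shadowed power density $\frac{\theta_1^{m-\mu}x^{\mu-1}}{\theta_2^m\Gamma(\mu)}e^{-x/\theta_1}{}_1F_1\left(m;\mu;\frac{(\theta_2-\theta_1)x}{\theta_1\theta_2}\right)$ with $\theta_1=\frac{1}{\mu(1+\kappa)}$, $\theta_2=\frac{\mu\kappa+m}{\mu(1+\kappa)m}$.) Unit-mean Nakagami power random variable with parameter $m_I>0$: a Gamma random variable with shape $m_I$ and scale $1/m_I$. EVM: a desired signal with fading power $g_d$ is received together with $L$ interferers with fading powers $g_1,\dots,g_L$ and zero-mean complex Gaussian noise of variance $\sigma^2$; with unit symbol energy, the error vector magnitude is $\mathrm{EVM}=\mathbb{E}\left[\sqrt{\left(\sum_{l=1}^L g_l+\sigma^2\right)/g_d}\right]$. ${}_1F_1$ is Kummer's confluent hypergeometric function, and $U(a,b,z)=\frac{1}{\Gamma(a)}\int_0^\infty e^{-zt}t^{a-1}(1+t)^{b-a-1}\,dt$ ($a,z>0$) is the Tricomi confluent hypergeometric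 function. *)

theory Defs
  imports "HOL-Probability.Probability"
begin

text \<open>
  Modified Bessel function of the first kind, intended for \<open>z > 0\<close> and real order.
  Using \<open>rGamma\<close> (which is \<open>0\<close> at the poles of \<open>Gamma\<close>) makes the series
  correct also for negative integer orders.
\<close>
definition bessel_I :: "real \<Rightarrow> real \<Rightarrow> real" where
  "bessel_I \<nu> z =
     (\<Sum>k. rGamma (real k + \<nu> + 1) / fact k * (z / 2) powr (2 * real k + \<nu>))"

definition kummer_1F1 :: "real \<Rightarrow> real \<Rightarrow> real \<Rightarrow> real" where
  "kummer_1F1 a b z = (\<Sum>n. pochhammer a n / pochhammer b n * z ^ n / fact n)"

text \<open>Integral representation, meaningful for \<open>a > 0\<close> and \<open>z > 0\<close>.\<close>
definition tricomi_U :: "real \<Rightarrow> real \<Rightarrow> real \<Rightarrow> real" where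
  "tricomi_U a b z = 1 / Gamma a *
     (LBINT t:{0<..}. exp (- z * t) * t powr (a - 1) * (1 + t) powr (b - a - 1))"

definition kappa_mu_density :: "real \<Rightarrow> real \<Rightarrow> real \<Rightarrow> real" where
  "kappa_mu_density \<kappa> \<mu> x =
     (if x > 0 then
        \<mu> * (1 + \<kappa>) powr ((\<mu> + 1) / 2) / (\<kappa> powr ((\<mu> - 1) / 2) * exp (\<mu> * \<kappa>))
        * x powr ((\<mu> - 1) / 2) * exp (- \<mu> * (1 + \<kappa>) * x)
        * bessel_I (\<mu> - 1) (2 * \<mu> * sqrt (\<kappa> * (1 + \<kappa>) * x))
      else 0)"

definition gamma_density :: "real \<Rightarrow> real \<Rightarrow> real \<Rightarrow> real" where
  "gamma_density k \<theta> x =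
     (if x > 0 then x powr (k - 1) * exp (- x / \<theta>) / (Gamma k * \<theta> powr k) else 0)"

definition kappa_mu_power :: "'a measure \<Rightarrow> ('a \<Rightarrow> real) \<Rightarrow> real \<Rightarrow> real \<Rightarrow> bool" where
  "kappa_mu_power M X \<kappa> \<mu> \<longleftrightarrow>
     distributed M lborel X (\<lambda>x. ennreal (kappa_mu_density \<kappa> \<mu> x))"

definition nakagami_power :: "'a measure \<Rightarrow> ('a \<Rightarrow> real) \<Rightarrow> real \<Rightarrow> bool" where
  "nakagami_power M X m \<longleftrightarrow>
     distributed M lborel X (\<lambda>x. ennreal (gamma_density m (1 / m) x))"

text \<open>
  Error vector magnitude for unit symbol energy: \<open>gd\<close> is the desired fading power,
  \<open>g 1, \<dots>, g L\<close> are the interfering ones, and \<open>v\<close> is the noise variance.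
\<close>
definition EVM ::
  "'a measure \<Rightarrow> ('a \<Rightarrow> real) \<Rightarrow> (nat \<Rightarrow> 'a \<Rightarrow> real) \<Rightarrow> nat \<Rightarrow> real \<Rightarrow> real" where
  "EVM M gd g L v =
     prob_space.expectation M (\<lambda>\<omega>. sqrt (((\<Sum>l=1..L. g l \<omega>) + v) / gd \<omega>))"

end

theory Submission
  imports Defs
begin

text \<open>
  By independence the expectation factors into \<open>E[sqrt (S + \<sigma>\<^sup>2)]\<close>, where \<open>S\<close> is the total
  interference, and \<open>E[1 / sqrt gd]\<close>. By the Beta integral, \<open>S\<close> is again gamma distributed, and
  substituting \<open>x = \<sigma>\<^sup>2 t\<close> in its density turns the first factor into the integral defining \<open>U\<close>.
  The Bessel series exhibits the density of \<open>gd\<close> as a Poisson mixture of gamma densities, so its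
  moments are series of Gamma quotients, namely \<open>exp (- \<kappa> \<mu>)\<close> times a Kummer series at \<open>\<kappa> \<mu>\<close>;
  Kummer's transformation, obtained from the Cauchy product and the Chu--Vandermonde identity,
  moves the argument to \<open>- \<kappa> \<mu>\<close>.
\<close>

section \<open>Kummer's transformation\<close>

text \<open>Consecutive Pochhammer quotients have ratio \<open>(a + n) / (b + n)\<close>, which
  never exceeds \<open>max 1 (a / b)\<close>, so an exponential series dominates. Absolute
  summability is what the Cauchy product requires.\<close>

lemma kummer_1F1_summable:
  fixes a b z :: real
  assumes "a > 0" "b > 0"
  shows "summable (\<lambda>n. \<bar>pochhammer a n / pochhammer b n * z ^ n / fact n\<bar>)"
proof (rule summable_comparison_test')
  define q where "q = max 1 (a / b)"
  show "summable (\<lambda>n. inverse (fact n) * (q * \<bar>z\<bar>) ^ n)"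
    by (rule summable_exp)
  show "norm \<bar>pochhammer a n / pochhammer b n * z ^ n / fact n\<bar> \<le> inverse (fact n) * (q * \<bar>z\<bar>) ^ n"
    if "n \<ge> 0" for n
  proof -
    have pos: "pochhammer a n > 0" "pochhammer b n > 0" for n
      using assms by (auto intro: pochhammer_pos)
    have step: "(a + real n) / (b + real n) \<le> q" for n
    proof (cases "a \<le> b")
      case True
      then have "(a + real n) / (b + real n) \<le> 1"
        using assms by (simp add: divide_le_eq)
      then show ?thesis by (simp add: q_def)
    next
      case False
      then have "b * real n \<le> a * real n"
        by (simp add: mult_right_mono)
      then have "(a + real n) / (b + real n) \<le> a / b"
        using assms by (simp add: field_simps add_pos_nonneg)
      then show ?thesis by (simp add: q_def)
    qed
    have "pochhammer a n / pochhammer b n \<le> q ^ n"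
    proof (induction n)
      case (Suc n)
      have "pochhammer a (Suc n) / pochhammer b (Suc n)
          = pochhammer a n / pochhammer b n * ((a + real n) / (b + real n))"
        by (simp add: pochhammer_Suc)
      also have "\<dots> \<le> q ^ n * q"
        using Suc step assms pos[of n]
        by (intro mult_mono) (auto simp: q_def intro!: divide_nonneg_pos)
      finally show ?case by (simp only: power_Suc2)
    qed simp
    then have "pochhammer a n / pochhammer b n * \<bar>z\<bar> ^ n / fact n \<le> q ^ n * \<bar>z\<bar> ^ n / fact n"
      by (intro divide_right_mono mult_right_mono) auto
    then show ?thesis
      using pos[of n] by (simp add: abs_mult power_abs field_simps)
  qed
qed

text \<open>This is the coefficient of \<open>z ^ n\<close> in the Kummer series times
  \<open>exp (- z)\<close>. It is a Chu-Vandermonde sum with parameters \<open>c\<close> and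
  \<open>1 - b - n\<close> in disguise.\<close>

lemma kummer_coefficient_sum:
  fixes b c :: real
  assumes "b > 0"
  shows "(\<Sum>k\<le>n. pochhammer c k / pochhammer b k / fact k * ((- 1) ^ (n - k) / fact (n - k)))
       = (- 1) ^ n * pochhammer (b - c) n / pochhammer b n / fact n"
proof -
  have pos: "pochhammer b k > 0" for k
    using assms by (auto intro: pochhammer_pos)
  \<comment> \<open>Splitting \<open>pochhammer b n\<close> at \<open>k\<close> and reflecting its
    second factor moves the dependence on \<open>k\<close> out of the denominator; the factorials
    combine to the binomial coefficient.\<close>
  have summand: "pochhammer c k / pochhammer b k / fact k * ((- 1) ^ (n - k) / fact (n - k))
      = of_nat (n choose k) * pochhammer c k * pochhammer (1 - b - real n) (n - k)
        / (pochhammer b n * fact n)" if "k \<le> n" for k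
  proof -
    have "pochhammer (1 - b - real n) (n - k)
        = (- 1) ^ (n - k) * pochhammer (b + real k) (n - k)"
      using pochhammer_minus[of "b + real n - 1" "n - k"] that
      by (simp add: of_nat_diff algebra_simps)
    moreover have "pochhammer b n = pochhammer b k * pochhammer (b + real k) (n - k)"
      using that by (rule pochhammer_product)
    moreover have "pochhammer (b + real k) (n - k) > 0"
      using assms by (auto intro: pochhammer_pos)
    ultimately show ?thesis
      using that pos[of k] by (simp add: binomial_fact field_simps)
  qed
  have "(\<Sum>k\<le>n. pochhammer c k / pochhammer b k / fact k * ((- 1) ^ (n - k) / fact (n - k)))
      = pochhammer (c + (1 - b - real n)) n / (pochhammer b n * fact n)"
    unfolding pochhammer_binomial_sum sum_divide_distrib
    by (intro sum.cong refl summand) simp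
  \<comment> \<open>The same reflection, now applied to the value of the Chu-Vandermonde
    sum.\<close>
  also have "pochhammer (c + (1 - b - real n)) n = (- 1) ^ n * pochhammer (b - c) n"
    using pochhammer_minus[of "b - c + real n - 1" n] by (simp add: algebra_simps)
  finally show ?thesis by (simp add: field_simps)
qed

text \<open>The Cauchy product also supplies convergence of the right-hand series, so
  \<open>b - c\<close> may have either sign. This matters for moments of order \<open>p\<close>,
  where \<open>b - c\<close> becomes \<open>- p\<close>.\<close>

theorem kummer_transformation:
  assumes "c > 0" "b > 0"
  shows "kummer_1F1 c b z * exp (- z) = kummer_1F1 (b - c) b (- z)"
proof -
  let ?f = "\<lambda>n. pochhammer c n / pochhammer b n * z ^ n / fact n"
  let ?g = "\<lambda>n. (- z) ^ n /\<^sub>R fact n"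
  have "(\<lambda>n. \<Sum>k\<le>n. ?f k * ?g (n - k)) sums ((\<Sum>n. ?f n) * (\<Sum>n. ?g n))"
    using kummer_1F1_summable[OF assms] summable_norm_exp[of "- z"]
    by (intro Cauchy_product_sums) simp_all
  moreover have "(\<Sum>k\<le>n. ?f k * ?g (n - k))
      = pochhammer (b - c) n / pochhammer b n * (- z) ^ n / fact n" for n
  proof -
    have "(\<Sum>k\<le>n. ?f k * ?g (n - k))
        = (\<Sum>k\<le>n. pochhammer c k / pochhammer b k / fact k
            * ((- 1) ^ (n - k) / fact (n - k)) * z ^ n)"
    proof (rule sum.cong[OF refl])
      fix k assume "k \<in> {..n}"
      then have "z ^ n = z ^ k * z ^ (n - k)"
        by (simp flip: power_add)
      then show "?f k * ?g (n - k) = pochhammer c k / pochhammer b k / fact k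
            * ((- 1) ^ (n - k) / fact (n - k)) * z ^ n"
        by (simp add: power_minus[of z] field_simps)
    qed
    also have "\<dots> = (- 1) ^ n * pochhammer (b - c) n / pochhammer b n / fact n * z ^ n"
      by (simp only: sum_distrib_right[symmetric] kummer_coefficient_sum[OF assms(2)])
    finally show ?thesis by (simp add: power_minus[of z])
  qed
  ultimately show ?thesis
    by (simp add: kummer_1F1_def exp_def sums_iff)
qed

section \<open>Gamma densities\<close>

lemma Gamma_real_nonzero [simp]: "x > 0 \<Longrightarrow> Gamma x \<noteq> (0 :: real)"
  using Gamma_real_pos[of x] by linarith

lemma Gamma_add_of_nat: "x > 0 \<Longrightarrow> Gamma (x + real k) = Gamma x * pochhammer x k"
  by (subst pochhammer_Gamma) (auto elim!: nonpos_Ints_cases)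

lemma gamma_density_nonneg: "k > 0 \<Longrightarrow> gamma_density k \<theta> x \<ge> 0"
  by (simp add: gamma_density_def)

lemma borel_measurable_gamma_density [measurable]: "gamma_density k \<theta> \<in> borel_measurable borel"
  unfolding gamma_density_def[abs_def] by measurable

text \<open>Substituting \<open>x = \<theta> * t\<close> leaves Euler's integral for
  \<open>Gamma (a + p)\<close>; \<open>p\<close> may be negative. The nonnegative integral yields
  value and finiteness together and can later be summed termwise.\<close>

lemma nn_integral_gamma_density_powr:
  assumes "a > 0" "\<theta> > 0" "a + p > 0"
  shows "(\<integral>\<^sup>+x. ennreal (gamma_density a \<theta> x * x powr p) \<partial>lborel)
       = ennreal (\<theta> powr p * Gamma (a + p) / Gamma a)"
proof -
  have "(\<integral>\<^sup>+x. ennreal (gamma_density a \<theta> x * x powr p) \<partial>lborel)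
      = ennreal \<theta> * (\<integral>\<^sup>+t. ennreal (gamma_density a \<theta> (\<theta> * t) * (\<theta> * t) powr p) \<partial>lborel)"
    using assms by (subst nn_integral_real_affine[where c=\<theta> and t=0]) auto
  also have "(\<integral>\<^sup>+t. ennreal (gamma_density a \<theta> (\<theta> * t) * (\<theta> * t) powr p) \<partial>lborel)
      = (\<integral>\<^sup>+t. ennreal (\<theta> powr (p - 1) / Gamma a)
            * ennreal (indicator {0..} t * t powr (a + p - 1) / exp t) \<partial>lborel)"
  proof (rule nn_integral_cong)
    fix t :: real
    have "gamma_density a \<theta> (\<theta> * t) * (\<theta> * t) powr p
        = \<theta> powr (p - 1) / Gamma a * (indicator {0..} t * t powr (a + p - 1) / exp t)"
    proof (cases "t > 0")
      case True
      then show ?thesis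
        using assms
        by (simp add: gamma_density_def powr_mult zero_less_mult_iff exp_minus powr_add powr_diff
            field_simps)
    next
      \<comment> \<open>At \<open>t = 0\<close> the indicator is 1, but \<open>0 powr _ = 0\<close>
        agrees with the vanishing density.\<close>
      case False
      then show ?thesis
        using assms by (cases "t = 0") (auto simp: gamma_density_def zero_less_mult_iff)
    qed
    then show "ennreal (gamma_density a \<theta> (\<theta> * t) * (\<theta> * t) powr p)
        = ennreal (\<theta> powr (p - 1) / Gamma a)
            * ennreal (indicator {0..} t * t powr (a + p - 1) / exp t)"
      using assms by (simp flip: ennreal_mult')
  qed
  also have "\<dots> = ennreal (\<theta> powr (p - 1) / Gamma a) * ennreal (Gamma (a + p))"
    using assms by (simp add: nn_integral_cmult Gamma_conv_nn_integral_real)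
  also have "ennreal \<theta> * \<dots> = ennreal (\<theta> powr p * Gamma (a + p) / Gamma a)"
    using assms by (simp add: powr_diff flip: ennreal_mult')
  finally show ?thesis .
qed

lemma integrable_gamma_density_powr:
  assumes "a > 0" "\<theta> > 0" "a + p > 0"
  shows "integrable lborel (\<lambda>x. gamma_density a \<theta> x * x powr p)"
  using assms nn_integral_gamma_density_powr[OF assms]
  by (intro integrableI_nonneg) (auto simp: gamma_density_nonneg)

section \<open>Sums of independent gamma variables\<close>

lemma nn_integral_Beta:
  assumes "a > 0" "b > (0 :: real)"
  shows "(\<integral>\<^sup>+t. ennreal (indicator {0..1} t * (t powr (a - 1) * (1 - t) powr (b - 1))) \<partial>lborel)
       = ennreal (Beta a b)"
  using nn_integral_has_integral_lebesgue[OF _ has_integral_Beta_real[OF assms]] by simp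

text \<open>With a common scale the product of the exponentials depends on \<open>x\<close> only.
  After \<open>y = x * t\<close> what remains is a Beta integral, whose value turns
  \<open>1 / (Gamma a * Gamma b)\<close> into \<open>1 / Gamma (a + b)\<close>.\<close>

lemma gamma_density_convolution:
  assumes "a > 0" "b > 0" "\<theta> > 0"
  shows "(\<integral>\<^sup>+y. ennreal (gamma_density a \<theta> (x - y)) * ennreal (gamma_density b \<theta> y) \<partial>lborel)
       = ennreal (gamma_density (a + b) \<theta> x)"
proof (cases "x > 0")
  case False
  then have "ennreal (gamma_density a \<theta> (x - y)) * ennreal (gamma_density b \<theta> y) = 0" for y
    by (simp add: gamma_density_def)
  with False show ?thesis by (simp only: nn_integral_const) (simp add: gamma_density_def)
next
  case True
  \<comment> \<open>All factors free of \<open>t\<close>. The exponent is \<open>a + b - 2\<close>;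
    the Jacobian \<open>x\<close> of the substitution raises it to \<open>a + b - 1\<close>.\<close>
  define C where "C = x powr (a + b - 2) * exp (- x / \<theta>) / (Gamma a * Gamma b * \<theta> powr (a + b))"
  have "C \<ge> 0" using assms by (simp add: C_def)
  have "(\<integral>\<^sup>+y. ennreal (gamma_density a \<theta> (x - y)) * ennreal (gamma_density b \<theta> y) \<partial>lborel)
      = (\<integral>\<^sup>+y. ennreal (gamma_density a \<theta> (x - y) * gamma_density b \<theta> y) \<partial>lborel)"
    using assms by (simp add: gamma_density_nonneg flip: ennreal_mult')
  also have "\<dots> = ennreal x
      * (\<integral>\<^sup>+t. ennreal (gamma_density a \<theta> (x - x * t) * gamma_density b \<theta> (x * t)) \<partial>lborel)"
    using True by (subst nn_integral_real_affine[where c=x and t=0]) auto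
  also have "(\<integral>\<^sup>+t. ennreal (gamma_density a \<theta> (x - x * t) * gamma_density b \<theta> (x * t)) \<partial>lborel)
      = (\<integral>\<^sup>+t. ennreal C
          * ennreal (indicator {0..1} t * (t powr (b - 1) * (1 - t) powr (a - 1))) \<partial>lborel)"
  proof (rule nn_integral_cong)
    fix t :: real
    have eq: "x - x * t = x * (1 - t)" by (simp add: algebra_simps)
    have "gamma_density a \<theta> (x - x * t) * gamma_density b \<theta> (x * t)
        = C * (indicator {0..1} t * (t powr (b - 1) * (1 - t) powr (a - 1)))"
    proof (cases "0 < t \<and> t < 1")
      case t: True
      have "x powr (a - 1) * x powr (b - 1) = x powr (a + b - 2)"
        by (simp add: algebra_simps flip: powr_add)
      moreover have "exp (- (x * (1 - t)) / \<theta>) * exp (- (x * t) / \<theta>) = exp (- x / \<theta>)"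
        using assms by (simp add: field_simps flip: exp_add)
      moreover have "gamma_density a \<theta> (x - x * t) * gamma_density b \<theta> (x * t)
          = (x powr (a - 1) * x powr (b - 1))
            * (exp (- (x * (1 - t)) / \<theta>) * exp (- (x * t) / \<theta>))
            / (Gamma a * Gamma b * \<theta> powr (a + b)) * (t powr (b - 1) * (1 - t) powr (a - 1))"
        using t True unfolding gamma_density_def eq
        by (simp add: powr_mult powr_add[of \<theta> a b] mult_ac)
      ultimately show ?thesis
        using t by (simp only: C_def) simp
    next
      \<comment> \<open>At the endpoints 0 and 1 the indicator is 1, and again
        \<open>0 powr _ = 0\<close> makes both sides vanish.\<close>
      case False
      then have "t \<le> 0 \<or> 1 \<le> t" by auto
      then show ?thesis
        using True unfolding gamma_density_def eq
        by (auto simp: zero_less_mult_iff indicator_def)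
    qed
    then show "ennreal (gamma_density a \<theta> (x - x * t) * gamma_density b \<theta> (x * t))
        = ennreal C * ennreal (indicator {0..1} t * (t powr (b - 1) * (1 - t) powr (a - 1)))"
      using \<open>C \<ge> 0\<close> by (simp flip: ennreal_mult')
  qed
  also have "\<dots> = ennreal C * ennreal (Beta b a)"
    using nn_integral_Beta[OF assms(2,1)] by (simp add: nn_integral_cmult)
  also have "ennreal x * \<dots> = ennreal (x * (C * Beta b a))"
    using \<open>C \<ge> 0\<close> True by (simp flip: ennreal_mult')
  also have "x * (C * Beta b a) = gamma_density (a + b) \<theta> x"
  proof -
    have "x * x powr (a + b - 2) = x powr (a + b - 1)"
      using True powr_add[of x 1 "a + b - 2"] by (simp add: algebra_simps)
    moreover have "Gamma a > 0" "Gamma b > 0" using assms by auto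
    ultimately show ?thesis
      using True by (simp add: gamma_density_def C_def Beta_def add.commute field_simps)
  qed
  finally show ?thesis .
qed

text \<open>Induction on the index set, each step being one convolution. The empty sum is excluded
  because the constant 0 has no density.\<close>

lemma (in prob_space) sum_indep_gamma:
  assumes "finite I" "I \<noteq> {}" "indep_vars (\<lambda>_. borel) X I" "\<theta> > 0"
    and "\<And>i. i \<in> I \<Longrightarrow> k i > 0"
    and "\<And>i. i \<in> I \<Longrightarrow> distributed M lborel (X i) (\<lambda>x. ennreal (gamma_density (k i) \<theta> x))"
  shows "distributed M lborel (\<lambda>\<omega>. \<Sum>i\<in>I. X i \<omega>)
           (\<lambda>x. ennreal (gamma_density (\<Sum>i\<in>I. k i) \<theta> x))"
  using assms
proof (induction I rule: finite_ne_induct)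
  case (singleton i)
  then show ?case by simp
next
  case (insert i I)
  have "indep_vars (\<lambda>_. borel) X I"
    using insert.prems(1) by (rule indep_vars_subset) auto
  with insert have "distributed M lborel (\<lambda>\<omega>. \<Sum>i\<in>I. X i \<omega>)
      (\<lambda>x. ennreal (gamma_density (\<Sum>i\<in>I. k i) \<theta> x))"
    by auto
  moreover have "indep_var borel (X i) borel (\<lambda>\<omega>. \<Sum>i\<in>I. X i \<omega>)"
    using insert by (intro indep_vars_sum) auto
  moreover have "distributed M lborel (X i) (\<lambda>x. ennreal (gamma_density (k i) \<theta> x))"
    using insert by auto
  moreover have "k i > 0" "(\<Sum>i\<in>I. k i) > 0"
    using insert by (auto intro: sum_pos)
  ultimately show ?case
    using insert distributed_convolution[of "X i" "\<lambda>\<omega>. \<Sum>i\<in>I. X i \<omega>"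
      "\<lambda>x. ennreal (gamma_density (k i) \<theta> x)" "\<lambda>x. ennreal (gamma_density (\<Sum>i\<in>I. k i) \<theta> x)"]
    by (simp add: gamma_density_convolution)
qed

section \<open>The interference-plus-noise factor and the Tricomi function\<close>

text \<open>Substituting \<open>x = v * t\<close> turns the root into
  \<open>sqrt v * sqrt (1 + t)\<close>. The exponent 1/2 of \<open>1 + t\<close> must equal
  \<open>b - a - 1\<close>, which forces \<open>b = 3 / 2 + a\<close>.\<close>

lemma integral_gamma_density_sqrt:
  assumes "a > 0" "m > 0" "v > 0"
  shows "(\<integral>x. gamma_density a (1 / m) x * sqrt (x + v) \<partial>lborel)
       = v powr (a + 1 / 2) * m powr a * tricomi_U a (3 / 2 + a) (v * m)"
proof -
  \<comment> \<open>The power of \<open>v\<close> collects \<open>a - 1\<close> from the density and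
    1/2 from the root; the Jacobian adds 1, giving \<open>a + 1 / 2\<close> in the result.\<close>
  define C where "C = v powr (a - 1 / 2) * m powr a / Gamma a"
  have "(\<integral>x. gamma_density a (1 / m) x * sqrt (x + v) \<partial>lborel)
      = v * (\<integral>t. gamma_density a (1 / m) (v * t) * sqrt (v * t + v) \<partial>lborel)"
    using assms by (subst lborel_integral_real_affine[where c=v and t=0]) auto
  also have "(\<lambda>t. gamma_density a (1 / m) (v * t) * sqrt (v * t + v))
      = (\<lambda>t. C * (indicator {0<..} t *\<^sub>R
          (exp (- (v * m) * t) * t powr (a - 1) * (1 + t) powr (3 / 2 + a - a - 1))))"
  proof
    fix t :: real
    show "gamma_density a (1 / m) (v * t) * sqrt (v * t + v)
      = C * (indicator {0<..} t *\<^sub>R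
          (exp (- (v * m) * t) * t powr (a - 1) * (1 + t) powr (3 / 2 + a - a - 1)))"
    proof (cases "t > 0")
      case True
      have "v * t + v = v * (1 + t)" by (simp add: algebra_simps)
      then have "sqrt (v * t + v) = v powr (1 / 2) * (1 + t) powr (1 / 2)"
        using True assms by (simp add: real_sqrt_mult powr_half_sqrt)
      moreover have "v powr (a - 1) * v powr (1 / 2) = v powr (a - 1 / 2)"
        by (simp flip: powr_add)
      ultimately show ?thesis
        using True assms
        by (simp add: gamma_density_def C_def powr_mult powr_divide field_simps)
    next
      case False
      then show ?thesis
        using assms by (simp add: gamma_density_def zero_less_mult_iff)
    qed
  qed
  also have "v * (\<integral>t. C * (indicator {0<..} t *\<^sub>R
          (exp (- (v * m) * t) * t powr (a - 1) * (1 + t) powr (3 / 2 + a - a - 1))) \<partial>lborel)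
      = v * C * Gamma a * tricomi_U a (3 / 2 + a) (v * m)"
    using assms Gamma_real_pos[of a]
    by (simp add: tricomi_U_def set_lebesgue_integral_def)
  also have "v * C * Gamma a = v powr (a + 1 / 2) * m powr a"
    using assms Gamma_real_pos[of a] powr_add[of v 1 "a - 1 / 2"]
    by (simp add: C_def field_simps)
  finally show ?thesis .
qed

lemma integrable_gamma_density_sqrt:
  assumes "a > 0" "\<theta> > 0" "v > 0"
  shows "integrable lborel (\<lambda>x. gamma_density a \<theta> x * sqrt (x + v))"
proof (rule Bochner_Integration.integrable_bound)
  \<comment> \<open>The bound comes from \<open>sqrt y \<le> y + 1\<close> at
    \<open>y = x + v\<close>. Writing 1 as \<open>x powr 0\<close> makes both summands gamma
    moments, of orders 1 and 0.\<close>
  show "integrable lborel (\<lambda>x. gamma_density a \<theta> x * x powr 1 + (v + 1) * (gamma_density a \<theta> x * x powr 0))"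
    using assms by (intro Bochner_Integration.integrable_add integrable_mult_right
      integrable_gamma_density_powr) auto
  show "AE x in lborel. norm (gamma_density a \<theta> x * sqrt (x + v))
      \<le> norm (gamma_density a \<theta> x * x powr 1 + (v + 1) * (gamma_density a \<theta> x * x powr 0))"
  proof (rule AE_I2)
    fix x :: real
    show "norm (gamma_density a \<theta> x * sqrt (x + v))
      \<le> norm (gamma_density a \<theta> x * x powr 1 + (v + 1) * (gamma_density a \<theta> x * x powr 0))"
    proof (cases "x > 0")
      case True
      have "sqrt (x + v) \<le> x + (v + 1)"
        using True assms by (intro real_le_lsqrt) (auto simp: power2_eq_square algebra_simps)
      then have "gamma_density a \<theta> x * sqrt (x + v) \<le> gamma_density a \<theta> x * (x + (v + 1))"
        using assms by (intro mult_left_mono gamma_density_nonneg)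
      then show ?thesis
        using True assms gamma_density_nonneg[OF assms(1), of \<theta> x]
        by (simp add: abs_mult algebra_simps)
    qed (simp add: gamma_density_def)
  qed
qed auto

section \<open>The \<open>\<kappa>\<close>-\<open>\<mu>\<close> power distribution\<close>

text \<open>Term by term, the Bessel series gives gamma densities of shape \<open>\<mu> + k\<close>
  and a common scale, mixed with Poisson weights of mean \<open>\<mu> * \<kappa>\<close>.\<close>

lemma kappa_mu_density_sums:
  assumes "\<kappa> > 0" "\<mu> > 0"
  shows "(\<lambda>k. exp (- \<mu> * \<kappa>) * (\<mu> * \<kappa>) ^ k / fact k
            * gamma_density (\<mu> + real k) (1 / (\<mu> * (1 + \<kappa>))) x) sums kappa_mu_density \<kappa> \<mu> x"
proof (cases "x > 0")
  case False
  then show ?thesis by (simp add: kappa_mu_density_def gamma_density_def)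
next
  case x: True
  define c where "c = \<mu> * (1 + \<kappa>)"
  have c: "c > 0" using assms by (simp add: c_def)
  define z where "z = 2 * \<mu> * sqrt (\<kappa> * (1 + \<kappa>) * x)"
  define A where "A = \<mu> * (1 + \<kappa>) powr ((\<mu> + 1) / 2) / (\<kappa> powr ((\<mu> - 1) / 2) * exp (\<mu> * \<kappa>))
        * x powr ((\<mu> - 1) / 2) * exp (- \<mu> * (1 + \<kappa>) * x)"
  let ?w = "\<lambda>k. exp (- \<mu> * \<kappa>) * (\<mu> * \<kappa>) ^ k / fact k * gamma_density (\<mu> + real k) (1 / c) x"
  let ?B = "\<lambda>k. rGamma (real k + (\<mu> - 1) + 1) / fact k * (z / 2) powr (2 * real k + (\<mu> - 1))"
  have A: "A > 0" using assms x by (simp add: A_def)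
  \<comment> \<open>Every positive factor is written as an exponential of logarithms, so that
    matching the terms for \<open>k\<close> reduces to the linear identity
    \<open>exponents\<close>.\<close>
  have z2: "z / 2 = exp (ln \<mu> + (ln \<kappa> + ln (1 + \<kappa>) + ln x) / 2)"
    using assms x by (simp add: z_def exp_add powr_half_sqrt[symmetric] powr_def ln_mult)
  have w_eq: "?w k = A * ?B k" for k
  proof -
    have "(\<mu> * \<kappa>) ^ k = exp (real k * (ln \<mu> + ln \<kappa>))"
      using assms by (simp add: ln_mult powr_def flip: powr_realpow)
    moreover have "ln c = ln \<mu> + ln (1 + \<kappa>)"
      using assms by (simp add: c_def ln_mult)
    then have "(1 / c) powr (\<mu> + real k) = 1 / exp ((\<mu> + real k) * (ln \<mu> + ln (1 + \<kappa>)))"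
      using c by (simp add: powr_divide) (simp add: powr_def)
    then have "gamma_density (\<mu> + real k) (1 / c) x = exp ((\<mu> + real k - 1) * ln x)
        * exp (- x * c) * exp ((\<mu> + real k) * (ln \<mu> + ln (1 + \<kappa>))) / Gamma (\<mu> + real k)"
      using x by (simp add: gamma_density_def powr_def[of x])
    ultimately have "?w k = (exp (- \<mu> * \<kappa>) * exp (real k * (ln \<mu> + ln \<kappa>))
        * exp ((\<mu> + real k - 1) * ln x) * exp (- x * c)
        * exp ((\<mu> + real k) * (ln \<mu> + ln (1 + \<kappa>)))) / (fact k * Gamma (\<mu> + real k))"
      by (simp add: mult_ac)
    then have w: "?w k = exp (- \<mu> * \<kappa> + real k * (ln \<mu> + ln \<kappa>) + (\<mu> + real k - 1) * ln x
        + - x * c + (\<mu> + real k) * (ln \<mu> + ln (1 + \<kappa>))) / (fact k * Gamma (\<mu> + real k))"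
      by (simp only: mult_exp_exp)
    have "A = exp (ln \<mu>) * exp ((\<mu> + 1) / 2 * ln (1 + \<kappa>))
        / (exp ((\<mu> - 1) / 2 * ln \<kappa>) * exp (\<mu> * \<kappa>))
        * exp ((\<mu> - 1) / 2 * ln x) * exp (- c * x)"
      using assms x by (simp add: A_def powr_def c_def)
    then have A_eq: "A = exp (ln \<mu> + (\<mu> + 1) / 2 * ln (1 + \<kappa>) - ((\<mu> - 1) / 2 * ln \<kappa> + \<mu> * \<kappa>)
        + (\<mu> - 1) / 2 * ln x + - c * x)"
      by (simp only: mult_exp_exp exp_diff[symmetric])
    have "real k + (\<mu> - 1) + 1 = \<mu> + real k" by simp
    then have "?B k = exp ((2 * real k + (\<mu> - 1)) * (ln \<mu> + (ln \<kappa> + ln (1 + \<kappa>) + ln x) / 2))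
        / (fact k * Gamma (\<mu> + real k))"
      unfolding z2 by (simp only: powr_def ln_exp rGamma_inverse_Gamma) (simp add: divide_simps)
    then have AB: "A * ?B k = exp (ln \<mu> + (\<mu> + 1) / 2 * ln (1 + \<kappa>) - ((\<mu> - 1) / 2 * ln \<kappa> + \<mu> * \<kappa>)
        + (\<mu> - 1) / 2 * ln x + - c * x
        + (2 * real k + (\<mu> - 1)) * (ln \<mu> + (ln \<kappa> + ln (1 + \<kappa>) + ln x) / 2))
        / (fact k * Gamma (\<mu> + real k))"
      by (simp only: A_eq times_divide_eq_right mult_exp_exp)
    have exponents: "- \<mu> * \<kappa> + real k * (ln \<mu> + ln \<kappa>) + (\<mu> + real k - 1) * ln x
        + - x * c + (\<mu> + real k) * (ln \<mu> + ln (1 + \<kappa>))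
      = ln \<mu> + (\<mu> + 1) / 2 * ln (1 + \<kappa>) - ((\<mu> - 1) / 2 * ln \<kappa> + \<mu> * \<kappa>)
        + (\<mu> - 1) / 2 * ln x + - c * x
        + (2 * real k + (\<mu> - 1)) * (ln \<mu> + (ln \<kappa> + ln (1 + \<kappa>) + ln x) / 2)"
      by (simp add: c_def field_simps)
    show ?thesis unfolding w AB exponents ..
  qed
  \<comment> \<open>\<open>bessel_I\<close> is a \<open>suminf\<close>, so its series must be shown
    to converge. Since \<open>pochhammer 1 k = fact k\<close>, the mixture terms are, up to a
    constant, those of a Kummer series with upper parameter 1 divided by \<open>fact k\<close>.
    Cancelling \<open>A > 0\<close> then gives convergence of the Bessel series.\<close>
  have "summable ?w"
  proof -
    have "summable (\<lambda>k. exp (- \<mu> * \<kappa>) * x powr (\<mu> - 1) * exp (- x * c) * c powr \<mu> / Gamma \<mu>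
        * (pochhammer 1 k / pochhammer \<mu> k * (\<mu> * \<kappa> * c * x) ^ k / fact k / fact k))"
    proof (rule summable_mult, rule summable_comparison_test'[where N=0])
      show "summable (\<lambda>k. \<bar>pochhammer 1 k / pochhammer \<mu> k * (\<mu> * \<kappa> * c * x) ^ k / fact k\<bar>)"
        using assms by (intro kummer_1F1_summable) auto
      show "norm (pochhammer 1 k / pochhammer \<mu> k * (\<mu> * \<kappa> * c * x) ^ k / fact k / fact k)
          \<le> \<bar>pochhammer 1 k / pochhammer \<mu> k * (\<mu> * \<kappa> * c * x) ^ k / fact k\<bar>" for k
      proof -
        have "\<bar>y / fact k\<bar> \<le> \<bar>y\<bar>" for y :: real
          using divide_left_mono[OF fact_ge_1[of k] abs_ge_zero[of y]] by simp
        then show ?thesis by (simp only: real_norm_def)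
      qed
    qed
    moreover have "?w k = exp (- \<mu> * \<kappa>) * x powr (\<mu> - 1) * exp (- x * c) * c powr \<mu> / Gamma \<mu>
        * (pochhammer 1 k / pochhammer \<mu> k * (\<mu> * \<kappa> * c * x) ^ k / fact k / fact k)" for k
    proof -
      have "x powr (\<mu> + real k - 1) = x powr (\<mu> - 1) * x ^ k"
          "c powr (\<mu> + real k) = c powr \<mu> * c ^ k"
        using x c by (simp_all add: powr_add powr_diff powr_realpow)
      then show ?thesis
        using x c assms
        by (simp add: gamma_density_def Gamma_add_of_nat powr_divide power_mult_distrib
            pochhammer_fact[symmetric] field_simps)
    qed
    ultimately show ?thesis by (simp only:)
  qed
  then have "summable (\<lambda>k. A * ?B k)"
    unfolding w_eq .
  then have "summable ?B"
    by (rule summable_mult_D) (use A in simp)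
  then have "(\<lambda>k. A * ?B k) sums (A * bessel_I (\<mu> - 1) z)"
    unfolding bessel_I_def by (intro sums_mult summable_sums)
  moreover have "kappa_mu_density \<kappa> \<mu> x = A * bessel_I (\<mu> - 1) z"
    using x by (simp add: kappa_mu_density_def A_def z_def)
  ultimately show ?thesis
    by (simp only: w_eq c_def[symmetric])
qed

lemma kappa_mu_density_nonneg: "\<kappa> > 0 \<Longrightarrow> \<mu> > 0 \<Longrightarrow> kappa_mu_density \<kappa> \<mu> x \<ge> 0"
  by (rule sums_le[OF _ sums_zero kappa_mu_density_sums]) (auto simp: gamma_density_nonneg)

section \<open>Power moments of the desired signal\<close>

text \<open>All terms of the mixture are nonnegative, so it integrates termwise. The quotients
  \<open>Gamma (\<mu> + k + p) / Gamma (\<mu> + k)\<close> form a Kummer series with parameters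
  \<open>\<mu> + p\<close> and \<open>\<mu>\<close>; Kummer's transformation changes the upper one
  to \<open>- p\<close>.\<close>

lemma nn_integral_kappa_mu_density_powr:
  assumes "\<kappa> > 0" "\<mu> > 0" "\<mu> + p > 0"
  shows "(\<integral>\<^sup>+x. ennreal (kappa_mu_density \<kappa> \<mu> x * x powr p) \<partial>lborel)
       = ennreal ((\<mu> * (1 + \<kappa>)) powr (- p) * (Gamma (\<mu> + p) / Gamma \<mu>)
           * kummer_1F1 (- p) \<mu> (- \<kappa> * \<mu>))"
proof -
  define \<theta> where "\<theta> = 1 / (\<mu> * (1 + \<kappa>))"
  have \<theta>: "\<theta> > 0" using assms by (simp add: \<theta>_def)
  define w where "w k = exp (- \<mu> * \<kappa>) * (\<mu> * \<kappa>) ^ k / fact k" for k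
  have w: "w k \<ge> 0" for k using assms by (simp add: w_def)
  let ?e = "\<lambda>k. w k * (\<theta> powr p * Gamma (\<mu> + real k + p) / Gamma (\<mu> + real k))"
  have "ennreal (kappa_mu_density \<kappa> \<mu> x * x powr p)
      = (\<Sum>k. ennreal (w k) * ennreal (gamma_density (\<mu> + real k) \<theta> x * x powr p))" for x
  proof -
    have "(\<lambda>k. w k * gamma_density (\<mu> + real k) \<theta> x * x powr p)
        sums (kappa_mu_density \<kappa> \<mu> x * x powr p)"
      using kappa_mu_density_sums[OF assms(1,2)] unfolding w_def \<theta>_def by (intro sums_mult2)
    then have "(\<Sum>k. ennreal (w k * gamma_density (\<mu> + real k) \<theta> x * x powr p))
        = ennreal (kappa_mu_density \<kappa> \<mu> x * x powr p)"
      using assms w by (intro suminf_ennreal_eq) (auto simp: gamma_density_nonneg)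
    then show ?thesis
      using w by (simp add: mult.assoc flip: ennreal_mult')
  qed
  then have "(\<integral>\<^sup>+x. ennreal (kappa_mu_density \<kappa> \<mu> x * x powr p) \<partial>lborel)
      = (\<Sum>k. ennreal (w k) * (\<integral>\<^sup>+x. ennreal (gamma_density (\<mu> + real k) \<theta> x * x powr p) \<partial>lborel))"
    by (simp add: nn_integral_suminf nn_integral_cmult)
  also have "\<dots> = (\<Sum>k. ennreal (?e k))"
    using assms \<theta> w by (simp add: nn_integral_gamma_density_powr flip: ennreal_mult')
  also have "\<dots> = ennreal (\<theta> powr p * (Gamma (\<mu> + p) / Gamma \<mu>)
      * (kummer_1F1 (\<mu> + p) \<mu> (\<mu> * \<kappa>) * exp (- (\<mu> * \<kappa>))))"
  proof (rule suminf_ennreal_eq)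
    show "?e k \<ge> 0" for k using assms w[of k] by simp
    have "(\<lambda>k. pochhammer (\<mu> + p) k / pochhammer \<mu> k * (\<mu> * \<kappa>) ^ k / fact k)
        sums kummer_1F1 (\<mu> + p) \<mu> (\<mu> * \<kappa>)"
      unfolding kummer_1F1_def using kummer_1F1_summable[OF assms(3,2), THEN summable_rabs_cancel]
      by (rule summable_sums)
    then have "(\<lambda>k. \<theta> powr p * (Gamma (\<mu> + p) / Gamma \<mu>)
        * (pochhammer (\<mu> + p) k / pochhammer \<mu> k * (\<mu> * \<kappa>) ^ k / fact k * exp (- (\<mu> * \<kappa>))))
        sums (\<theta> powr p * (Gamma (\<mu> + p) / Gamma \<mu>)
          * (kummer_1F1 (\<mu> + p) \<mu> (\<mu> * \<kappa>) * exp (- (\<mu> * \<kappa>))))"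
      by (intro sums_mult sums_mult2)
    moreover have "?e k = \<theta> powr p * (Gamma (\<mu> + p) / Gamma \<mu>)
        * (pochhammer (\<mu> + p) k / pochhammer \<mu> k * (\<mu> * \<kappa>) ^ k / fact k * exp (- (\<mu> * \<kappa>)))" for k
      using assms Gamma_add_of_nat[of \<mu> k] Gamma_add_of_nat[of "\<mu> + p" k]
      by (simp add: w_def ac_simps)
    ultimately show "?e sums (\<theta> powr p * (Gamma (\<mu> + p) / Gamma \<mu>)
          * (kummer_1F1 (\<mu> + p) \<mu> (\<mu> * \<kappa>) * exp (- (\<mu> * \<kappa>))))"
      by simp
  qed
  also have "kummer_1F1 (\<mu> + p) \<mu> (\<mu> * \<kappa>) * exp (- (\<mu> * \<kappa>)) = kummer_1F1 (- p) \<mu> (- \<kappa> * \<mu>)"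
    using kummer_transformation[OF assms(3,2), of "\<mu> * \<kappa>"] by (simp add: mult.commute)
  also have "\<theta> powr p = (\<mu> * (1 + \<kappa>)) powr (- p)"
    using assms by (simp add: \<theta>_def powr_divide powr_minus_divide)
  finally show ?thesis .
qed

text \<open>The moment of order \<open>p = - 1 / 2\<close>, for which \<open>\<mu> + p > 0\<close>
  reads \<open>\<mu> > 1 / 2\<close>. Integrability is included because factoring the EVM needs
  it.\<close>

lemma kappa_mu_power_inverse_sqrt:
  assumes "kappa_mu_power M X \<kappa> \<mu>" "\<kappa> > 0" "\<mu> > 1 / 2"
  shows "has_bochner_integral M (\<lambda>\<omega>. 1 / sqrt (X \<omega>))
    (sqrt (\<mu> * (1 + \<kappa>)) * (Gamma (\<mu> - 1 / 2) / Gamma \<mu>) * kummer_1F1 (1 / 2) \<mu> (- \<kappa> * \<mu>))"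
    (is "has_bochner_integral M _ ?r")
proof -
  have D: "distributed M lborel X (\<lambda>x. ennreal (kappa_mu_density \<kappa> \<mu> x))"
    using assms(1) by (simp add: kappa_mu_power_def)
  have nonneg: "kappa_mu_density \<kappa> \<mu> x \<ge> 0" for x
    using assms by (intro kappa_mu_density_nonneg) auto
  have [measurable]: "kappa_mu_density \<kappa> \<mu> \<in> borel_measurable lborel"
    using distributed_real_measurable[OF _ D] nonneg by simp
  \<comment> \<open>For \<open>x \<le> 0\<close> the density vanishes, so the differing conventions
    of \<open>sqrt\<close> and \<open>powr\<close> there do no harm.\<close>
  have eq: "kappa_mu_density \<kappa> \<mu> x * (1 / sqrt x) = kappa_mu_density \<kappa> \<mu> x * x powr (- 1 / 2)" for x
    by (cases "x > 0") (simp_all add: kappa_mu_density_def powr_minus_divide powr_half_sqrt)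
  have "(\<integral>\<^sup>+x. ennreal (kappa_mu_density \<kappa> \<mu> x * (1 / sqrt x)) \<partial>lborel) = ennreal ?r"
    unfolding eq using nn_integral_kappa_mu_density_powr[of \<kappa> \<mu> "- 1 / 2"] assms
    by (simp add: powr_half_sqrt)
  \<comment> \<open>\<open>ennreal\<close> truncates negative values, so the sign of
    \<open>?r\<close> is needed to return to reals. This series alternates, but the other side of
    Kummer's transformation has nonnegative terms only.\<close>
  moreover have "kummer_1F1 (1 / 2) \<mu> (- \<kappa> * \<mu>) \<ge> 0"
  proof -
    have "kummer_1F1 (\<mu> - 1 / 2) \<mu> (\<mu> * \<kappa>) \<ge> 0"
      unfolding kummer_1F1_def using assms
      by (intro suminf_nonneg summable_rabs_cancel[OF kummer_1F1_summable])
        (auto intro!: divide_nonneg_nonneg mult_nonneg_nonneg pochhammer_nonneg)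
    then show ?thesis
      using kummer_transformation[of "\<mu> - 1 / 2" \<mu> "\<mu> * \<kappa>", symmetric] assms
      by (simp add: mult.commute)
  qed
  then have "?r \<ge> 0"
    using assms by (intro mult_nonneg_nonneg) auto
  ultimately have "has_bochner_integral lborel (\<lambda>x. kappa_mu_density \<kappa> \<mu> x * (1 / sqrt x)) ?r"
    using nonneg
    by (intro has_bochner_integral_nn_integral)
      (auto simp: eq intro!: AE_I2 mult_nonneg_nonneg simp del: times_divide_eq_right)
  then show ?thesis
    using distributed_integrable[OF D, of "\<lambda>x. 1 / sqrt x"]
      distributed_integral[OF D, of "\<lambda>x. 1 / sqrt x"] nonneg
    by (simp add: has_bochner_integral_iff)
qed

section \<open>Factorization of the EVM\<close>

theorem corollary5:
  fixes M :: "'a measure"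
    and gd :: "'a \<Rightarrow> real" and g :: "nat \<Rightarrow> 'a \<Rightarrow> real"
    and L :: nat and \<sigma> mI \<kappa> \<mu> :: real
  assumes "prob_space M"
    and "L \<ge> 1" and "\<sigma>\<^sup>2 > 0" and "mI > 0" and "\<kappa> > 0" and "\<mu> > 0"
    and "prob_space.indep_vars M (\<lambda>_. borel) (\<lambda>i. if i = 0 then gd else g i) {0..L}"
    and "kappa_mu_power M gd \<kappa> \<mu>"
    and "\<And>l. l \<in> {1..L} \<Longrightarrow> nakagami_power M (g l) mI"
    and "\<mu> > 0.5"
  shows "EVM M gd g L (\<sigma>\<^sup>2) =
    (\<sigma>\<^sup>2) powr (mI * real L + 0.5)
    * tricomi_U (mI * real L) (3 / 2 + mI * real L) (\<sigma>\<^sup>2 * mI)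
    * sqrt (\<mu> * (1 + \<kappa>)) * (Gamma (\<mu> - 0.5) / Gamma \<mu>)
    * kummer_1F1 (1 / 2) \<mu> (- \<kappa> * \<mu>) * mI powr (mI * real L)"
proof -
  interpret prob_space M by fact
  let ?X = "\<lambda>i. if i = 0 then gd else g i"
  define S where "S \<omega> = (\<Sum>l=1..L. g l \<omega>)" for \<omega>
  let ?a = "mI * real L"
  have a: "?a > 0" using assms by simp
  \<comment> \<open>Index 0 of the independent family carries \<open>gd\<close>. On
    \<open>{1..L}\<close> the family agrees with \<open>g\<close>, so \<open>S\<close> is a sum over
    the remaining indices and hence independent of \<open>gd\<close>.\<close>
  have S_eq: "S = (\<lambda>\<omega>. \<Sum>l\<in>{1..L}. ?X l \<omega>)"
    by (auto simp: S_def fun_eq_iff intro!: sum.cong)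
  have ins: "{0..L} = insert 0 {1..L}" by auto
  have "distributed M lborel (\<lambda>\<omega>. \<Sum>l\<in>{1..L}. ?X l \<omega>)
      (\<lambda>x. ennreal (gamma_density (\<Sum>l\<in>{1..L}. mI) (1 / mI) x))"
    using assms by (intro sum_indep_gamma indep_vars_subset[OF assms(7)])
      (auto simp: nakagami_power_def)
  then have D: "distributed M lborel S (\<lambda>x. ennreal (gamma_density ?a (1 / mI) x))"
    by (simp add: S_eq mult.commute)
  have "indep_var borel (?X 0) borel S"
    unfolding S_eq using assms(7) ins by (intro indep_vars_sum) auto
  then have "indep_var borel ((\<lambda>x. 1 / sqrt x) \<circ> ?X 0) borel ((\<lambda>x. sqrt (x + \<sigma>\<^sup>2)) \<circ> S)"
    by (rule indep_var_compose) auto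
  moreover have "has_bochner_integral M (\<lambda>\<omega>. 1 / sqrt (gd \<omega>))
    (sqrt (\<mu> * (1 + \<kappa>)) * (Gamma (\<mu> - 1 / 2) / Gamma \<mu>) * kummer_1F1 (1 / 2) \<mu> (- \<kappa> * \<mu>))"
    using assms by (intro kappa_mu_power_inverse_sqrt) auto
  moreover have "integrable M (\<lambda>\<omega>. sqrt (S \<omega> + \<sigma>\<^sup>2))"
    using distributed_integrable[OF D, of "\<lambda>x. sqrt (x + \<sigma>\<^sup>2)"] a assms
      integrable_gamma_density_sqrt[of ?a "1 / mI" "\<sigma>\<^sup>2"] gamma_density_nonneg[of ?a]
    by simp
  moreover have "expectation (\<lambda>\<omega>. sqrt (S \<omega> + \<sigma>\<^sup>2))
      = (\<sigma>\<^sup>2) powr (?a + 1 / 2) * mI powr ?a * tricomi_U ?a (3 / 2 + ?a) (\<sigma>\<^sup>2 * mI)"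
    using distributed_integral[OF D, of "\<lambda>x. sqrt (x + \<sigma>\<^sup>2)"] a assms
      integral_gamma_density_sqrt[of ?a mI "\<sigma>\<^sup>2"] gamma_density_nonneg[of ?a]
    by simp
  \<comment> \<open>Independence alone does not split the expectation of a product; the
    integrability of both factors established above is used here.\<close>
  ultimately have "expectation (\<lambda>\<omega>. 1 / sqrt (gd \<omega>) * sqrt (S \<omega> + \<sigma>\<^sup>2))
      = sqrt (\<mu> * (1 + \<kappa>)) * (Gamma (\<mu> - 1 / 2) / Gamma \<mu>) * kummer_1F1 (1 / 2) \<mu> (- \<kappa> * \<mu>)
        * ((\<sigma>\<^sup>2) powr (?a + 1 / 2) * mI powr ?a * tricomi_U ?a (3 / 2 + ?a) (\<sigma>\<^sup>2 * mI))"
    by (subst indep_var_lebesgue_integral) (auto simp: has_bochner_integral_iff o_def)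
  then show ?thesis
    by (simp add: EVM_def S_def real_sqrt_divide)
qed

end
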